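(* The semigroup $M_2(\bar{\mathbb{R}})$ of all $2 \times 2$ tropical matrices is regular; that is, for every $X \in M_2(\bar{\mathbb{R}})$ there is $Y \in M_2(\bar{\mathbb{R}})$ with $XYX = X$.
   Context: $\bar{\mathbb{R}} = \mathbb{R} \cup \{-\infty\}$ is the tropical semiring with $a \otimes b = a+b$ (with $-\infty$ absorbing) and $a \oplus b = \max\{a,b\}$. $M_2(\bar{\mathbb{R}})$ is the set of $2 \times 2$ matrices over $\bar{\mathbb{R}}$ under tropical matrix multiplication $(AB)_{ij} = \max_{k} (A_{ik} + B_{kj})$. *)

theory Defs
  imports "HOL-Analysis.Finite_Cartesian_Product"
begin

datatype trop = NegInf | Fin real

text \<open>The usual order of the reals, with \<open>NegInf\<close> as least element.\<close>

instantiation trop :: linorder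
begin

fun less_eq_trop :: "trop \<Rightarrow> trop \<Rightarrow> bool" where
  "NegInf \<le> b \<longleftrightarrow> True"
| "Fin x \<le> NegInf \<longleftrightarrow> False"
| "Fin x \<le> Fin y \<longleftrightarrow> x \<le> y"

definition less_trop :: "trop \<Rightarrow> trop \<Rightarrow> bool" where
  "a < b \<longleftrightarrow> a \<le> b \<and> \<not> b \<le> (a :: trop)"

instance
proof
  fix a b c :: trop
  show "a < b \<longleftrightarrow> a \<le> b \<and> \<not> b \<le> a"
    by (rule less_trop_def)
  show "a \<le> a"
    by (cases a) auto
  show "a \<le> b \<Longrightarrow> b \<le> c \<Longrightarrow> a \<le> c"
    by (cases a; cases b; cases c) auto
  show "a \<le> b \<Longrightarrow> b \<le> a \<Longrightarrow> a = b"
    by (cases a; cases b) auto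
  show "a \<le> b \<or> b \<le> a"
    by (cases a; cases b) auto
qed

end

text \<open>
  The semiring operations \<open>+\<close> and \<open>*\<close> on \<^typ>\<open>trop\<close> are the tropical ones, so that the generic
  matrix product \<open>**\<close> over \<^typ>\<open>trop\<close> is the tropical matrix product.
\<close>

instantiation trop :: comm_semiring_1
begin

definition zero_trop :: trop where
  "0 = NegInf"

definition one_trop :: trop where
  "1 = Fin 0"

definition plus_trop :: "trop \<Rightarrow> trop \<Rightarrow> trop" where
  "a + b = max a (b :: trop)"

fun times_trop :: "trop \<Rightarrow> trop \<Rightarrow> trop" where
  "NegInf * b = NegInf"
| "Fin x * NegInf = NegInf"
| "Fin x * Fin y = Fin (x + y)"

instance
proof
  fix a b c :: trop
  show "a * b * c = a * (b * c)"
    by (cases a; cases b; cases c) auto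
  show "a * b = b * a"
    by (cases a; cases b) auto
  show "1 * a = a"
    by (cases a) (auto simp: one_trop_def)
  show "a + b + c = a + (b + c)"
    by (simp add: plus_trop_def max.assoc)
  show "a + b = b + a"
    by (simp add: plus_trop_def max.commute)
  show "0 + a = a"
    by (simp add: plus_trop_def zero_trop_def max_def)
  show "0 * a = 0" "a * 0 = 0"
    by (cases a; simp add: zero_trop_def)+
  show "(a + b) * c = a * c + b * c"
    by (cases a; cases b; cases c) (auto simp: plus_trop_def max_def)
  show "(0 :: trop) \<noteq> 1"
    by (simp add: zero_trop_def one_trop_def)
qed

end

lemma trop_sum_eq_Max:
  fixes f :: "'a \<Rightarrow> trop"
  assumes "finite A" "A \<noteq> {}"
  shows "sum f A = Max (f ` A)"
  using assms
proof (induction A rule: finite_ne_induct)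
  case (singleton x)
  show ?case
    by simp
next
  case (insert x A)
  then show ?case
    by (simp add: plus_trop_def)
qed

lemma trop_matrix_mult_nth:
  fixes A :: "trop ^ 'n ^ 'm" and B :: "trop ^ 'p ^ 'n"
  shows "(A ** B) $ i $ j = Max (range (\<lambda>k. A $ i $ k * B $ k $ j))"
  by (simp add: matrix_matrix_mult_def trop_sum_eq_Max)

locale regular_semigroup = semigroup f for f :: "'a \<Rightarrow> 'a \<Rightarrow> 'a"  (infixl \<open>\<^bold>*\<close> 70) +
  assumes regular: "\<exists>y. x \<^bold>* y \<^bold>* x = x"

end

theory Submission
  imports Defs "HOL-Analysis.Cartesian_Space"
begin

text \<open>
  The product \<^term>\<open>(**)\<close> is associative over every semiring, so the content is the existence of
  inner inverses.  Over a field, the adjugate of an invertible matrix, divided by the determinant,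
  is its inverse.  Addition in the tropical semiring is idempotent, and there the adjugate with its
  signs left out does almost as well: if \<open>X\<close> has rows \<open>(a, b)\<close> and \<open>(c, d)\<close>, and \<open>X'\<close> has
  rows \<open>(d, b)\<close> and \<open>(c, a)\<close>, then the product \<open>X X' X\<close> is \<open>X\<close> scaled by the permanent \<open>ad + bc\<close>.
  Hence \<open>X'\<close> divided by the permanent is an inner inverse, whenever the permanent is invertible.

  In the tropical semiring every element other than \<open>0\<close> (that is, \<open>-\<infinity>\<close>) is invertible, so only
  permanent \<open>0\<close> is left.  Then \<open>ad = bc = 0\<close>, hence all nonzero entries lie in a single row
  or a single column, and inverting one nonzero entry in the transposed position suffices.
\<close>

text \<open>
  Expanding the entries of the triple product gives those of \<open>X\<close> times the permanent, except that
  some monomials occur twice: the top left entry is \<open>a(ad + bc) + abc\<close>, for instance.  Idempotency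
  absorbs these repetitions.
\<close>

lemma inner_inverse_if_permanent_invertible:
  fixes X :: "'a::comm_semiring_1 ^ 2 ^ 2"
  assumes idem: "\<And>x::'a. x + x = x"
    and inv: "(X $ 1 $ 1 * X $ 2 $ 2 + X $ 1 $ 2 * X $ 2 $ 1) * s = 1"
  shows "\<exists>Y. X ** Y ** X = X"
proof -
  define a b c d where abcd: "a = X $ 1 $ 1" "b = X $ 1 $ 2" "c = X $ 2 $ 1" "d = X $ 2 $ 2"
  define Y :: "'a ^ 2 ^ 2" where
    "Y = (\<chi> i j. s * (if i = j then (if i = 1 then d else a) else X $ i $ j))"
  have idem_left: "x + (x + y) = x + y" for x y :: 'a
    using idem by (metis add.assoc)
  note absorb = idem idem_left abcd [symmetric] algebra_simps
  have scale: "x = x * (a * d + b * c) * s" for x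
    using inv by (simp add: abcd mult.assoc)
  have entries:
    "(X ** Y ** X) $ 1 $ 1 = a * (a * d + b * c) * s"
    "(X ** Y ** X) $ 1 $ 2 = b * (a * d + b * c) * s"
    "(X ** Y ** X) $ 2 $ 1 = c * (a * d + b * c) * s"
    "(X ** Y ** X) $ 2 $ 2 = d * (a * d + b * c) * s"
    by (simp_all add: matrix_matrix_mult_def sum_2 Y_def absorb)
  have "X ** Y ** X = X"
    by (simp add: vec_eq_iff forall_2 entries abcd [symmetric] scale [symmetric])
  then show ?thesis ..
qed

text \<open>
  The only nonzero entry of the inner inverse is \<open>t\<close>, in position \<open>(q, p)\<close>.  The triple product is
  then the rank one matrix with entries \<open>X\<^sub>i\<^sub>q t X\<^sub>p\<^sub>j\<close>, which agrees with \<open>X\<close> in row \<open>p\<close> and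
  column \<open>q\<close>.  Everywhere else both vanish by assumption: as the pivot is invertible, \<open>entry\<close> says
  that \<open>X\<close> does.
\<close>

lemma inner_inverse_by_pivot:
  fixes X :: "'a::comm_semiring_1 ^ 'n ^ 'm"
  assumes pivot: "X $ p $ q * t = 1"
    and entry: "\<And>i j. i \<noteq> p \<Longrightarrow> j \<noteq> q \<Longrightarrow> X $ p $ q * X $ i $ j = 0"
    and cross: "\<And>i j. i \<noteq> p \<Longrightarrow> j \<noteq> q \<Longrightarrow> X $ i $ q * X $ p $ j = 0"
  shows "\<exists>Y. X ** Y ** X = X"
proof -
  define Y :: "'a ^ 'm ^ 'n" where "Y = (\<chi> k l. if k = q \<and> l = p then t else 0)"
  have XY: "(X ** Y) $ i $ l = (if l = p then X $ i $ q * t else 0)" for i l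
    by (simp add: matrix_matrix_mult_def Y_def if_distrib [of "(*) _"] cong: if_cong)
  have XYX: "(X ** Y ** X) $ i $ j = X $ i $ q * t * X $ p $ j" for i j
    by (subst matrix_matrix_mult_def) (simp add: XY if_distrib [of "\<lambda>x. x * _"] cong: if_cong)
  have "X $ i $ q * t * X $ p $ j = X $ i $ j" for i j
  proof (cases "i = p \<or> j = q")
    case True
    then show ?thesis
      using pivot by (metis mult.commute mult.left_commute mult_1)
  next
    case False
    then have "X $ i $ j = 0"
      using entry [of i j] pivot by (metis mult.commute mult.left_commute mult_1 mult_zero_right)
    moreover have "X $ i $ q * t * X $ p $ j = 0"
      using False cross [of i j] by (metis mult.commute mult.left_commute mult_zero_right)
    ultimately show ?thesis
      by simp
  qed
  then have "X ** Y ** X = X"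
    by (simp add: vec_eq_iff XYX)
  then show ?thesis ..
qed

lemma trop_add_idem: "x + x = (x :: trop)"
  by (simp add: plus_trop_def)

lemma trop_add_eq_0_iff: "x + y = 0 \<longleftrightarrow> x = 0 \<and> y = (0 :: trop)"
  by (cases x; cases y) (auto simp: plus_trop_def zero_trop_def max_def)

lemma trop_right_inverse:
  fixes x :: trop
  assumes "x \<noteq> 0"
  obtains s where "x * s = 1"
proof (cases x)
  case NegInf
  with assms show ?thesis
    by (simp add: zero_trop_def)
next
  case (Fin r)
  then have "x * Fin (- r) = 1"
    by (simp add: one_trop_def)
  then show ?thesis ..
qed

lemma trop_matrix_inner_inverse:
  fixes X :: "trop ^ 2 ^ 2"
  shows "\<exists>Y. X ** Y ** X = X"
proof (cases "X $ 1 $ 1 * X $ 2 $ 2 + X $ 1 $ 2 * X $ 2 $ 1 = 0")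
  case False
  then show ?thesis
    by (elim trop_right_inverse) (rule inner_inverse_if_permanent_invertible [OF trop_add_idem])
next
  case True
  then have diagonals: "X $ 1 $ 1 * X $ 2 $ 2 = 0" "X $ 1 $ 2 * X $ 2 $ 1 = 0"
    by (simp_all add: trop_add_eq_0_iff)
  (* Two positions that share neither row nor column form one of the two diagonals. *)
  have opposite: "X $ p $ q * X $ i $ j = 0" if "i \<noteq> p" "j \<noteq> q" for i j p q
    using that exhaust_2 [of i] exhaust_2 [of j] exhaust_2 [of p] exhaust_2 [of q] diagonals
    by (auto simp: mult.commute)
  show ?thesis
  proof (cases "X = 0")
    case True
    then have "X ** 0 ** X = X"
      by (simp add: matrix_matrix_mult_def vec_eq_iff)
    then show ?thesis ..
  next
    case False
    then obtain p q where "X $ p $ q \<noteq> 0"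
      by (auto simp: vec_eq_iff)
    then obtain t where "X $ p $ q * t = 1"
      by (rule trop_right_inverse)
    then show ?thesis
      by (rule inner_inverse_by_pivot) (auto intro: opposite)
  qed
qed

theorem theorem4p2:
  "regular_semigroup ((**) :: trop ^ 2 ^ 2 \<Rightarrow> trop ^ 2 ^ 2 \<Rightarrow> trop ^ 2 ^ 2)"
proof
  fix A B C :: "trop ^ 2 ^ 2"
  show "A ** B ** C = A ** (B ** C)"
    by (rule matrix_mul_assoc [symmetric])
next
  fix X :: "trop ^ 2 ^ 2"
  show "\<exists>Y. X ** Y ** X = X"
    by (rule trop_matrix_inner_inverse)
qed

end
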